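(* Let $\psi\in\Psi_\infty$ have $\infty$-Schoenberg sequence $(b_n)_{n\in\mathbb{N}_0}$. (a) The mont\'ee $I_S\psi$ is well-defined and in $\Psi_\infty$ if and only if $$\sum_{n=0}^\infty b_n\frac{(-1)^n}{n+1}\ge 0.$$ In this case it has $\infty$-Schoenberg sequence $(a_n)_{n\in\mathbb{N}_0}$ with $a_n=b_{n-1}/(nG_1)$ for $n\ge 1$ and $a_0=\frac{1}{G_1}\sum_{n=0}^\infty(-1)^nb_n/(n+1)$, where $G_1:=2\sum_{n=0}^\infty b_{2n}/(2n+1)$. (b) The condition $\sum_{n=0}^\infty b_n(-1)^n/(n+1)\ge 0$ is equivalent to $\int_{\pi/2}^\pi\sin\theta\,\psi(\theta)\,\mathrm{d}\theta\ge 0$. (c) Suppose that $\psi$ is not identically equal to $1$. The descente $D_S\psi$ is well-defined and in $\Psi_\infty$ if and only if $G_2:=\sum_{n=0}^\infty b_{n+1}(n+1)<\infty$. In this case it has $\infty$-Schoenberg sequence $(c_n)_{n\in\mathbb{N}_0}$ with $c_n=b_{n+1}(n+1)/G_2$. (d) The condition $G_2<\infty$ in (c) is equivalent to $|\psi''(0)|<\infty$ (i.e. to the existence of $\psi''(0)$ as a finite number).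
   Context: For an integer $d\ge 1$, $\mathbb{S}^d=\{x\in\mathbb{R}^{d+1}:\|x\|=1\}$ and $\theta(x,y)=\arccos(\langle x,y\rangle)$ for $x,y\in\mathbb{S}^d$. A function $g:\mathbb{S}^d\times\mathbb{S}^d\to\mathbb{R}$ is positive definite if $\sum_{i=1}^n\sum_{j=1}^n c_ic_j g(x_i,x_j)\ge 0$ for all $n \ge 1$, $x_i\in\mathbb{S}^d$, $c_i\in\mathbb{R}$. $\Psi_d$ is the class of continuous $\psi:[0,\pi]\to\mathbb{R}$ with $\psi(0)=1$ such that $g(x,y)=\psi(\theta(x,y))$ is positive definite on $\mathbb{S}^d$, and $\Psi_\infty:=\bigcap_{d=1}^\infty\Psi_d$. By Schoenberg's theorem, $\Psi_\infty$ consists exactly of the functions $\psi(\theta)=\sum_{n=0}^\infty b_n(\cos\theta)^n$, $\theta\in[0,\pi]$, with $b_n\ge 0$ and $\sum_{n=0}^\infty b_n=1$; the (unique) sequence $(b_n)_{n\in\mathbb{N}_0}$ is the $\infty$-Schoenberg sequence of $\psi$. Mont\'ee on spheres: for $\psi:[0,\pi]\to\mathbb{R}$ such that $\int_0^\pi\sin(\beta)\psi(\beta)\,\mathrm{d}\beta$ is finite and non-zero (this is what "well-defined" means), $$I_S\psi(\theta):=\frac{\int_\theta^\pi\sin(\beta)\psi(\beta)\,\mathrm{d}\beta}{\int_0^\pi\sin(\beta)\psi(\beta)\,\mathrm{d}\beta},\quad\theta\in[0,\pi].$$ Derivatives of $\psi$ at $0$ are those of the even continuation $\theta\mapsto\psi(|\theta|)$,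 $\theta\in[-\pi,\pi]$, at $\theta=0$. Descente on spheres: if $\psi:[0,\pi]\to\mathbb{R}$ is differentiable and has a finite second derivative $\psi''(0)\ne 0$ (this is what "well-defined" means), then $D_S\psi(\theta):=\psi'(\theta)/(\sin(\theta)\psi''(0))$, $\theta\in(0,\pi)$. The statement $D_S\psi\in\Psi_\infty$ is understood for the continuous extension of $D_S\psi$ to $[0,\pi]$. *)

theory Defs
  imports "HOL-Analysis.Analysis"
begin

(* The dimension d is quantified over in the definition of Psi_inf, so the sphere is the carrier of
   the library's nsphere d: the sequences x :: nat => real vanishing at all indices above d, with
   x 0 ^ 2 + ... + x d ^ 2 = 1. *)
abbreviation sphere_pts :: "nat \<Rightarrow> (nat \<Rightarrow> real) set" where
  "sphere_pts d \<equiv> topspace (nsphere d)"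

definition sphere_angle :: "nat \<Rightarrow> (nat \<Rightarrow> real) \<Rightarrow> (nat \<Rightarrow> real) \<Rightarrow> real" where
  "sphere_angle d x y = arccos (\<Sum>i\<le>d. x i * y i)"

definition positive_definite_on :: "'a set \<Rightarrow> ('a \<Rightarrow> 'a \<Rightarrow> real) \<Rightarrow> bool" where
  "positive_definite_on X g \<longleftrightarrow>
     (\<forall>n\<ge>1. \<forall>(x :: nat \<Rightarrow> 'a) (c :: nat \<Rightarrow> real). (\<forall>i<n. x i \<in> X) \<longrightarrow>
        (\<Sum>i<n. \<Sum>j<n. c i * c j * g (x i) (x j)) \<ge> 0)"

(* Functions on [0,pi] are total functions on the reals; every notion below depends only on their
   values on [0,pi]. *)

definition Psi :: "nat \<Rightarrow> (real \<Rightarrow> real) set" where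
  "Psi d = {\<psi>. continuous_on {0..pi} \<psi> \<and> \<psi> 0 = 1 \<and>
              positive_definite_on (sphere_pts d) (\<lambda>x y. \<psi> (sphere_angle d x y))}"

definition Psi_inf :: "(real \<Rightarrow> real) set" where
  "Psi_inf = (\<Inter>d\<in>{1..}. Psi d)"

definition schoenberg_seq :: "(real \<Rightarrow> real) \<Rightarrow> (nat \<Rightarrow> real) \<Rightarrow> bool" where
  "schoenberg_seq \<psi> b \<longleftrightarrow>
     (\<forall>n. b n \<ge> 0) \<and> b sums 1 \<and> (\<forall>\<theta>\<in>{0..pi}. (\<lambda>n. b n * cos \<theta> ^ n) sums \<psi> \<theta>)"

definition montee_well_defined :: "(real \<Rightarrow> real) \<Rightarrow> bool" where
  "montee_well_defined \<psi> \<longleftrightarrow>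
     (\<lambda>\<beta>. sin \<beta> * \<psi> \<beta>) integrable_on {0..pi} \<and> integral {0..pi} (\<lambda>\<beta>. sin \<beta> * \<psi> \<beta>) \<noteq> 0"

definition montee :: "(real \<Rightarrow> real) \<Rightarrow> real \<Rightarrow> real" where
  "montee \<psi> \<theta> =
     integral {\<theta>..pi} (\<lambda>\<beta>. sin \<beta> * \<psi> \<beta>) / integral {0..pi} (\<lambda>\<beta>. sin \<beta> * \<psi> \<beta>)"

definition even_continuation :: "(real \<Rightarrow> real) \<Rightarrow> real \<Rightarrow> real" where
  "even_continuation \<psi> \<theta> = \<psi> \<bar>\<theta>\<bar>"

definition has_finite_second_deriv_0 :: "(real \<Rightarrow> real) \<Rightarrow> bool" where
  "has_finite_second_deriv_0 \<psi> \<longleftrightarrow>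
     (\<forall>\<^sub>F \<theta> in nhds 0. even_continuation \<psi> differentiable (at \<theta>)) \<and>
     deriv (even_continuation \<psi>) differentiable (at 0)"

definition second_deriv_0 :: "(real \<Rightarrow> real) \<Rightarrow> real" where
  "second_deriv_0 \<psi> = deriv (deriv (even_continuation \<psi>)) 0"

definition descente_well_defined :: "(real \<Rightarrow> real) \<Rightarrow> bool" where
  "descente_well_defined \<psi> \<longleftrightarrow>
     \<psi> differentiable_on {0..pi} \<and> has_finite_second_deriv_0 \<psi> \<and> second_deriv_0 \<psi> \<noteq> 0"

(* Meaningful only for \<theta> in the open interval (0,pi). *)
definition descente :: "(real \<Rightarrow> real) \<Rightarrow> real \<Rightarrow> real" where
  "descente \<psi> \<theta> = deriv \<psi> \<theta> / (sin \<theta> * second_deriv_0 \<psi>)"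

definition is_continuous_extension :: "(real \<Rightarrow> real) \<Rightarrow> (real \<Rightarrow> real) \<Rightarrow> bool" where
  "is_continuous_extension f \<phi> \<longleftrightarrow>
     continuous_on {0..pi} \<phi> \<and> (\<forall>\<theta>\<in>{0<..<pi}. \<phi> \<theta> = f \<theta>)"

end

theory Submission
  imports Defs
begin

text \<open>A cosine power series \<open>\<Sum>n. a n * cos \<theta> ^ n\<close> may be differentiated term by term when
  \<open>\<Sum>n. n * \<bar>a n\<bar>\<close> converges. Applied to \<open>a n = b (n - 1) / n\<close> this gives an antiderivative for the montee,
  and applied to \<open>b\<close> itself it gives the descente. Every cosine power series with nonnegative
  coefficients is positive definite by the Schur product theorem. Conversely, only one consequence of
  positive definiteness on all spheres is needed: the value at the right angle is nonnegative,
  and for the montee that value is \<open>A / G1\<close>. Finally, a finite second derivative at \<open>0\<close> bounds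
  \<open>(1 - \<psi> \<theta>) / \<theta>\<^sup>2 = \<Sum>n. b n * (1 - cos \<theta> ^ n) / \<theta>\<^sup>2\<close> near \<open>0\<close>; each summand tends to
  \<open>b n * n / 2\<close>, so the partial sums of \<open>\<Sum>n. n * b n\<close> are bounded.\<close>

section \<open>Cosine power series: convergence, continuity, derivative\<close>

text \<open>Defined on the whole line, so that its derivatives at \<open>0\<close> and
  \<open>pi\<close> are two-sided, whereas only the values of \<open>\<psi>\<close> on the closed
  interval matter.\<close>

definition cos_series :: "(nat \<Rightarrow> real) \<Rightarrow> real \<Rightarrow> real" where
  "cos_series a \<theta> = (\<Sum>n. a n * cos \<theta> ^ n)"

lemma abs_mult_cos_power_le: "\<bar>a * cos \<theta> ^ n\<bar> \<le> \<bar>a :: real\<bar>"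
  by (simp add: abs_mult power_abs mult_left_le power_le_one)

lemma cos_series_sums:
  assumes "summable (\<lambda>n. \<bar>a n\<bar>)"
  shows "(\<lambda>n. a n * cos \<theta> ^ n) sums cos_series a \<theta>"
  unfolding cos_series_def
proof (rule summable_sums, rule summable_comparison_test'[OF assms])
  show "norm (a n * cos \<theta> ^ n) \<le> \<bar>a n\<bar>" for n
    using abs_mult_cos_power_le by simp
qed

lemma continuous_on_cos_series:
  assumes "summable (\<lambda>n. \<bar>a n\<bar>)"
  shows "continuous_on S (cos_series a)"
proof -
  have "uniform_limit S (\<lambda>n \<theta>. \<Sum>i<n. a i * cos \<theta> ^ i) (cos_series a) sequentially"
    unfolding cos_series_def
    by (rule Weierstrass_m_test[OF _ assms]) (use abs_mult_cos_power_le in simp)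
  then show ?thesis
    by (rule uniform_limit_theorem[rotated])
       (auto intro!: always_eventually continuous_intros)
qed

text \<open>The derived terms are bounded by \<open>\<bar>real n * a n\<bar>\<close> for all angles
  at once, so they sum uniformly on the line. With \<open>- sin \<theta>\<close> taken out, what is
  left is again a cosine series.\<close>

lemma has_real_derivative_cos_series:
  assumes a: "summable (\<lambda>n. \<bar>a n\<bar>)" and a': "summable (\<lambda>n. \<bar>a (n + 1) * (real n + 1)\<bar>)"
  shows "(cos_series a has_real_derivative - sin \<theta> * cos_series (\<lambda>n. a (n + 1) * (real n + 1)) \<theta>) (at \<theta>)"
proof -
  define f' where "f' n t = a n * (real n * cos t ^ (n - 1) * - sin t)" for n t
  have bound: "\<bar>f' n t\<bar> \<le> \<bar>real n * a n\<bar>" for n t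
  proof -
    have "\<bar>f' n t\<bar> = \<bar>real n * a n * cos t ^ (n - 1)\<bar> * \<bar>sin t\<bar>"
      by (simp add: f'_def abs_mult algebra_simps)
    also have "\<dots> \<le> \<bar>real n * a n\<bar> * 1"
      by (intro mult_mono abs_mult_cos_power_le) auto
    finally show ?thesis by simp
  qed
  have bound_summable: "summable (\<lambda>n. \<bar>real n * a n\<bar>)"
    using a' summable_Suc_iff[of "\<lambda>n. \<bar>real n * a n\<bar>"] by (simp add: algebra_simps)
  have "uniformly_convergent_on UNIV (\<lambda>n t. \<Sum>i<n. f' i t)"
    unfolding uniformly_convergent_on_def
    by (rule exI, rule Weierstrass_m_test[OF _ bound_summable]) (simp add: bound)
  moreover have "((\<lambda>t. a n * cos t ^ n) has_real_derivative f' n t) (at t)" for n t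
    unfolding f'_def by (auto intro!: derivative_eq_intros)
  ultimately have deriv: "(cos_series a has_real_derivative (\<Sum>n. f' n \<theta>)) (at \<theta>)"
    unfolding cos_series_def[abs_def]
    using cos_series_sums[OF a, of \<theta>]
    by (intro has_field_derivative_series'(2)[where S = UNIV and ?x0.0 = \<theta>]) (auto simp: sums_iff)
  have "summable (\<lambda>n. f' n \<theta>)"
    by (rule summable_comparison_test'[OF bound_summable]) (simp add: bound)
  \<comment> \<open>The term at index \<open>0\<close> carries the factor \<open>real 0\<close>;
    dropping it and shifting turns the exponent \<open>n - 1\<close> into \<open>n\<close>.\<close>
  then have "(\<Sum>n. f' n \<theta>) = (\<Sum>n. f' (Suc n) \<theta>)"
    using suminf_split_head[of "\<lambda>n. f' n \<theta>"] by (simp add: f'_def[of 0])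
  also have "\<dots> = (\<Sum>n. - sin \<theta> * (a (n + 1) * (real n + 1) * cos \<theta> ^ n))"
    by (simp add: f'_def algebra_simps)
  also have "\<dots> = - sin \<theta> * cos_series (\<lambda>n. a (n + 1) * (real n + 1)) \<theta>"
    unfolding cos_series_def
    using cos_series_sums[OF a', of \<theta>] by (intro suminf_mult) (auto simp: sums_iff)
  finally show ?thesis using deriv by simp
qed

section \<open>Positive definiteness on spheres\<close>

text \<open>Expanding one factor over the coordinates \<open>k\<close> turns the weights
  \<open>c i\<close> into \<open>c i * x i k\<close>, so the form of exponent \<open>Suc m\<close>
  is a sum over \<open>k\<close> of forms of exponent \<open>m\<close>. Hence the induction leaves
  \<open>c\<close> arbitrary.\<close>

lemma gram_power_nonneg:
  fixes x :: "nat \<Rightarrow> nat \<Rightarrow> real" and c :: "nat \<Rightarrow> real"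
  shows "(\<Sum>i<n. \<Sum>j<n. c i * c j * (\<Sum>k\<le>d. x i k * x j k) ^ m) \<ge> 0"
proof (induction m arbitrary: c)
  case 0
  have "(\<Sum>i<n. \<Sum>j<n. c i * c j) = (\<Sum>i<n. c i) * (\<Sum>i<n. c i)"
    by (simp add: sum_product)
  then show ?case by simp
next
  case (Suc m)
  define S where "S i j = (\<Sum>k\<le>d. x i k * x j k)" for i j
  have "(\<Sum>i<n. \<Sum>j<n. c i * c j * S i j ^ Suc m) =
        (\<Sum>i<n. \<Sum>j<n. c i * c j * S i j ^ m * (\<Sum>k\<le>d. x i k * x j k))"
    by (simp add: S_def algebra_simps)
  also have "\<dots> = (\<Sum>i<n. \<Sum>j<n. \<Sum>k\<le>d. (c i * x i k) * (c j * x j k) * S i j ^ m)"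
    by (simp add: sum_distrib_left algebra_simps)
  also have "\<dots> = (\<Sum>i<n. \<Sum>k\<le>d. \<Sum>j<n. (c i * x i k) * (c j * x j k) * S i j ^ m)"
    by (intro sum.cong refl sum.swap)
  also have "\<dots> = (\<Sum>k\<le>d. \<Sum>i<n. \<Sum>j<n. (c i * x i k) * (c j * x j k) * S i j ^ m)"
    by (rule sum.swap)
  also have "\<dots> \<ge> 0"
    unfolding S_def by (intro sum_nonneg Suc.IH)
  finally show ?case unfolding S_def .
qed

lemma abs_inner_sphere_le_1:
  assumes "x \<in> sphere_pts d" "y \<in> sphere_pts d"
  shows "\<bar>\<Sum>i\<le>d. x i * y i\<bar> \<le> 1"
  using Cauchy_Schwarz_ineq_sum[of x y "{..d}"] assms
  by (simp add: nsphere abs_square_le_1)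

lemma schoenberg_seqD:
  assumes "schoenberg_seq \<psi> b"
  shows "b n \<ge> 0" "summable b" "summable (\<lambda>n. \<bar>b n\<bar>)" "b sums 1" "suminf b = 1"
    "\<theta> \<in> {0..pi} \<Longrightarrow> \<psi> \<theta> = cos_series b \<theta>"
  using assms unfolding schoenberg_seq_def cos_series_def by (auto simp: sums_iff)

text \<open>The easy half of Schoenberg's theorem: the quadratic form of \<open>\<psi>\<close> is
  the sum over \<open>m\<close> of \<open>b m\<close> times the form of the \<open>m\<close>-th
  powers of a Gram matrix.\<close>

lemma schoenberg_seq_imp_Psi_inf:
  assumes "schoenberg_seq \<psi> b"
  shows "\<psi> \<in> Psi_inf"
proof -
  note b = schoenberg_seqD[OF assms]
  have "continuous_on {0..pi} \<psi>"
    using continuous_on_cos_series[OF b(3), of "{0..pi}"] by (rule continuous_on_eq) (simp add: b(6))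
  moreover have "\<psi> 0 = 1"
    using b(5) b(6)[of 0] by (simp add: cos_series_def)
  moreover have "positive_definite_on (sphere_pts d) (\<lambda>x y. \<psi> (sphere_angle d x y))" for d
    unfolding positive_definite_on_def
  proof (intro allI impI)
    fix n :: nat and x :: "nat \<Rightarrow> nat \<Rightarrow> real" and c :: "nat \<Rightarrow> real"
    assume x: "\<forall>i<n. x i \<in> sphere_pts d"
    define S where "S i j = (\<Sum>k\<le>d. x i k * x j k)" for i j
    have "(\<lambda>m. b m * S i j ^ m) sums \<psi> (sphere_angle d (x i) (x j))" if "i < n" "j < n" for i j
    proof -
      have "\<bar>S i j\<bar> \<le> 1"
        unfolding S_def using x that by (intro abs_inner_sphere_le_1) auto
      then have S: "- 1 \<le> S i j" "S i j \<le> 1" by auto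
      \<comment> \<open>\<open>cos_arccos\<close> is held back until the angle
        \<open>arccos (S i j)\<close> has been matched with the series in the definition.\<close>
      then have "(\<lambda>m. b m * cos (arccos (S i j)) ^ m) sums \<psi> (arccos (S i j))"
        using assms arccos_lbound[OF S] arccos_ubound[OF S] unfolding schoenberg_seq_def
        by (simp del: cos_arccos)
      then show ?thesis using S by (simp add: sphere_angle_def S_def)
    qed
    then have "(\<lambda>m. \<Sum>i<n. \<Sum>j<n. c i * c j * (b m * S i j ^ m)) sums
               (\<Sum>i<n. \<Sum>j<n. c i * c j * \<psi> (sphere_angle d (x i) (x j)))"
      by (intro sums_sum sums_mult) auto
    moreover have "(\<Sum>i<n. \<Sum>j<n. c i * c j * (b m * S i j ^ m)) \<ge> 0" for m
    proof -
      have "(\<Sum>i<n. \<Sum>j<n. c i * c j * (b m * S i j ^ m)) =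
            b m * (\<Sum>i<n. \<Sum>j<n. c i * c j * S i j ^ m)"
        by (simp add: sum_distrib_left algebra_simps)
      also have "\<dots> \<ge> 0"
        unfolding S_def by (intro mult_nonneg_nonneg b(1) gram_power_nonneg)
      finally show ?thesis .
    qed
    ultimately show "(\<Sum>i<n. \<Sum>j<n. c i * c j * \<psi> (sphere_angle d (x i) (x j))) \<ge> 0"
      by - (rule sums_le[OF _ sums_zero], assumption+)
  qed
  ultimately show ?thesis by (auto simp: Psi_inf_def Psi_def)
qed

text \<open>Evaluating the quadratic form at \<open>n\<close> orthonormal vectors gives
  \<open>n + n (n - 1) \<psi> (pi / 2) \<ge> 0\<close> for every \<open>n\<close>.\<close>

lemma Psi_inf_right_angle_nonneg:
  assumes "\<psi> \<in> Psi_inf"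
  shows "\<psi> (pi / 2) \<ge> 0"
proof (rule ccontr)
  assume "\<not> \<psi> (pi / 2) \<ge> 0"
  then have neg: "- \<psi> (pi / 2) > 0" by simp
  obtain m where m: "1 < real m * - \<psi> (pi / 2)"
    using ex_less_of_nat_mult[OF neg] by blast
  \<comment> \<open>At \<open>n\<close> orthonormal vectors the form is
    \<open>n * (1 + m * \<psi> (pi / 2))\<close>, negative by the choice of \<open>m\<close>. As
    \<open>n\<close> is at least \<open>1\<close>, it is an admissible dimension, and its sphere,
    with coordinates \<open>0\<close> to \<open>n\<close>, contains \<open>n\<close> such
    vectors.\<close>
  define n where "n = Suc m"
  define e :: "nat \<Rightarrow> nat \<Rightarrow> real" where "e i k = (if k = i then 1 else 0)" for i k
  have e: "e i \<in> sphere_pts n" if "i < n" for i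
    using that by (auto simp: nsphere e_def if_distrib[of "\<lambda>x. x ^ 2"] cong: if_cong)
  have "\<psi> 0 = 1" and pd: "positive_definite_on (sphere_pts n) (\<lambda>x y. \<psi> (sphere_angle n x y))"
    using assms by (auto simp: Psi_inf_def Psi_def n_def)
  have inner: "(\<Sum>k\<le>n. e i k * e j k) = (if i = j then 1 else 0)" if "i < n" for i j
    using that by (simp add: e_def if_distrib[of "\<lambda>x. x * _"] cong: if_cong)
  have "0 \<le> (\<Sum>i<n. \<Sum>j<n. 1 * 1 * \<psi> (sphere_angle n (e i) (e j)))"
    using pd e unfolding positive_definite_on_def
    by (elim allE[of _ n] impE allE[of _ e] allE[of _ "\<lambda>_. 1"]) (auto simp: n_def simp del: sum.lessThan_Suc)
  \<comment> \<open>The diagonal value \<open>1\<close> is split so that every entry carries the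
    off-diagonal value and the remainder is a diagonal matrix.\<close>
  also have "\<dots> = (\<Sum>i<n. \<Sum>j<n. (if i = j then 1 - \<psi> (pi / 2) else 0) + \<psi> (pi / 2))"
    by (intro sum.cong refl) (auto simp: sphere_angle_def inner \<open>\<psi> 0 = 1\<close>)
  also have "\<dots> = real n * (1 + real m * \<psi> (pi / 2))"
    by (simp add: sum.distrib n_def algebra_simps)
  finally show False using m by (simp add: zero_le_mult_iff n_def)
qed

section \<open>The second derivative at zero\<close>

text \<open>Cosine is even, so the absolute value disappears and derivatives at \<open>0\<close> can
  be read off the series.\<close>

lemma eventually_even_continuation_eq:
  assumes "schoenberg_seq \<psi> b"
  shows "\<forall>\<^sub>F \<theta> in nhds 0. even_continuation \<psi> \<theta> = cos_series b \<theta>"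
proof -
  have "\<forall>\<^sub>F \<theta> in nhds 0. \<theta> \<in> {- pi<..<pi}"
    by (rule eventually_nhds_in_open) auto
  then show ?thesis
  proof eventually_elim
    case (elim \<theta>)
    then show ?case
      using schoenberg_seqD(6)[OF assms, of "\<bar>\<theta>\<bar>"]
      by (simp add: even_continuation_def cos_series_def abs_le_iff)
  qed
qed

lemma has_real_derivative_sin_mult:
  assumes "isCont h 0"
  shows "((\<lambda>t. sin t * h t) has_real_derivative h 0) (at 0)"
proof -
  have "((\<lambda>t. (sin t / t) * h t) \<longlongrightarrow> 1 * h 0) (at 0)"
    using DERIV_sin[of 0] assms
    by (intro tendsto_mult) (auto simp: has_field_derivative_iff isCont_def)
  then show ?thesis by (simp add: has_field_derivative_iff)
qed

lemma second_deriv_0_if_summable: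
  assumes \<psi>: "schoenberg_seq \<psi> b" and sm: "summable (\<lambda>n. b (n + 1) * (real n + 1))"
  shows "has_finite_second_deriv_0 \<psi>"
    and "second_deriv_0 \<psi> = - (\<Sum>n. b (n + 1) * (real n + 1))"
proof -
  note b = schoenberg_seqD[OF \<psi>]
  define h where "h = cos_series (\<lambda>n. b (n + 1) * (real n + 1))"
  have sm': "summable (\<lambda>n. \<bar>b (n + 1) * (real n + 1)\<bar>)"
    using sm b(1) by (simp add: abs_mult)
  have D: "(cos_series b has_real_derivative - sin \<theta> * h \<theta>) (at \<theta>)" for \<theta>
    unfolding h_def by (rule has_real_derivative_cos_series[OF b(3) sm'])
  \<comment> \<open>To transfer the derivative at each nearby point, the two functions must agree on
    a neighbourhood of that point.\<close>
  have "\<forall>\<^sub>F \<theta> in nhds 0. \<forall>\<^sub>F t in nhds \<theta>. even_continuation \<psi> t = cos_series b t"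
    using eventually_even_continuation_eq[OF \<psi>] by (subst eventually_eventually)
  then have D': "\<forall>\<^sub>F \<theta> in nhds 0. (even_continuation \<psi> has_real_derivative - sin \<theta> * h \<theta>) (at \<theta>)"
  proof eventually_elim
    case (elim \<theta>)
    show ?case using D DERIV_cong_ev[OF refl elim refl] by blast
  qed
  have "isCont h 0"
    using continuous_on_cos_series[OF sm', of UNIV] unfolding h_def
    by (simp add: continuous_on_eq_continuous_at)
  then have "((\<lambda>\<theta>. sin \<theta> * h \<theta>) has_real_derivative h 0) (at 0)"
    by (rule has_real_derivative_sin_mult)
  then have "((\<lambda>\<theta>. - sin \<theta> * h \<theta>) has_real_derivative - h 0) (at 0)"
    using DERIV_minus by fastforce
  moreover have "\<forall>\<^sub>F \<theta> in nhds 0. deriv (even_continuation \<psi>) \<theta> = - sin \<theta> * h \<theta>"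
    using D' by eventually_elim (rule DERIV_imp_deriv)
  ultimately have D2: "(deriv (even_continuation \<psi>) has_real_derivative - h 0) (at 0)"
    by (simp add: DERIV_cong_ev[OF refl _ refl])
  then show "has_finite_second_deriv_0 \<psi>"
    using D' unfolding has_finite_second_deriv_0_def
    by (auto elim!: eventually_mono simp: real_differentiable_def)
  show "second_deriv_0 \<psi> = - (\<Sum>n. b (n + 1) * (real n + 1))"
    using DERIV_imp_deriv[OF D2] by (simp add: second_deriv_0_def h_def cos_series_def)
qed

lemma deriv_even_at_0:
  fixes g :: "real \<Rightarrow> real"
  assumes "\<And>t. g (- t) = g t" and "g differentiable (at 0)"
  shows "deriv g 0 = 0"
proof -
  have "(g has_real_derivative deriv g 0) (at 0)"
    using assms(2) by (simp add: DERIV_deriv_iff_real_differentiable)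
  moreover from this have "(g has_real_derivative - deriv g 0) (at 0)"
    using DERIV_mirror[of g "deriv g 0" 0] assms(1) by simp
  ultimately have "deriv g 0 = - deriv g 0"
    by (rule DERIV_unique)
  then show ?thesis by simp
qed

text \<open>The first derivative vanishes at \<open>0\<close> by evenness, so its quotient by
  \<open>t\<close> tends to the second derivative and is bounded near \<open>0\<close>. The mean
  value theorem turns this linear bound on the derivative into a quadratic bound on the
  function.\<close>

lemma quadratic_bound_if_second_deriv_0:
  assumes "has_finite_second_deriv_0 \<psi>"
  obtains K where "\<forall>\<^sub>F \<theta> in at_right 0. \<bar>\<psi> \<theta> - \<psi> 0\<bar> \<le> K * \<theta>\<^sup>2"
proof -
  define g where "g = even_continuation \<psi>"
  have diff: "\<forall>\<^sub>F \<theta> in nhds 0. g differentiable (at \<theta>)"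
    and "deriv g differentiable (at 0)"
    using assms by (auto simp: has_finite_second_deriv_0_def g_def)
  then obtain L where "(deriv g has_real_derivative L) (at 0)"
    by (auto simp: real_differentiable_def)
  moreover have "deriv g 0 = 0"
    using deriv_even_at_0[of g] eventually_nhds_x_imp_x[OF diff]
    by (simp add: g_def even_continuation_def)
  ultimately have "((\<lambda>t. deriv g t / t) \<longlongrightarrow> L) (at 0)"
    by (simp add: has_field_derivative_iff)
  then have "\<forall>\<^sub>F t in at 0. \<bar>deriv g t / t\<bar> < \<bar>L\<bar> + 1"
    by (intro order_tendstoD(2)[OF tendsto_rabs]) auto
  moreover have "\<forall>\<^sub>F \<theta> in at 0. g differentiable (at \<theta>)"
    using diff by (simp add: eventually_nhds_conv_at)
  ultimately have "\<forall>\<^sub>F t in at 0. \<bar>deriv g t / t\<bar> < \<bar>L\<bar> + 1 \<and> g differentiable (at t)"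
    by (rule eventually_conj)
  then obtain d where d: "d > 0"
    "\<And>t. t \<noteq> 0 \<Longrightarrow> \<bar>t\<bar> < d \<Longrightarrow> \<bar>deriv g t / t\<bar> < \<bar>L\<bar> + 1 \<and> g differentiable (at t)"
    by (auto simp: eventually_at)
  have "\<bar>\<psi> \<theta> - \<psi> 0\<bar> \<le> (\<bar>L\<bar> + 1) * \<theta>\<^sup>2" if "0 < \<theta>" "\<theta> < d" for \<theta>
  proof -
    have diff': "g differentiable (at t)" if "0 \<le> t" "t \<le> \<theta>" for t
      using that \<open>\<theta> < d\<close> d(2)[of t] eventually_nhds_x_imp_x[OF diff] by (cases "t = 0") auto
    then obtain z where z: "0 < z" "z < \<theta>" "g \<theta> - g 0 = (\<theta> - 0) * deriv g z"
      using MVT2[of 0 \<theta> g "deriv g"] \<open>0 < \<theta>\<close>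
      by (auto simp: DERIV_deriv_iff_real_differentiable)
    have "\<bar>deriv g z\<bar> = \<bar>deriv g z / z\<bar> * z" using z by simp
    also have "\<dots> \<le> (\<bar>L\<bar> + 1) * \<theta>"
      using d(2)[of z] z \<open>\<theta> < d\<close> by (intro mult_mono) auto
    finally have "\<theta> * \<bar>deriv g z\<bar> \<le> \<theta> * ((\<bar>L\<bar> + 1) * \<theta>)"
      using \<open>0 < \<theta>\<close> by (intro mult_left_mono) auto
    then show ?thesis
      using z \<open>0 < \<theta>\<close> by (simp add: g_def even_continuation_def abs_mult power2_eq_square algebra_simps)
  qed
  then have "\<forall>\<^sub>F \<theta> in at_right 0. \<bar>\<psi> \<theta> - \<psi> 0\<bar> \<le> (\<bar>L\<bar> + 1) * \<theta>\<^sup>2"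
    using \<open>d > 0\<close> unfolding eventually_at_right_field by blast
  then show thesis by (rule that)
qed

text \<open>A geometric sum of \<open>n\<close> terms, each tending to \<open>1\<close>, splits off
  the factor \<open>1 - cos \<theta>\<close>, which is
  \<open>sin \<theta> ^ 2 / (1 + cos \<theta>)\<close> near \<open>0\<close>.\<close>

lemma tendsto_one_minus_cos_power:
  "((\<lambda>\<theta>. (1 - cos \<theta> ^ n) / \<theta>\<^sup>2) \<longlongrightarrow> real n / 2) (at (0::real))"
proof -
  have "((\<lambda>\<theta>. sin \<theta> / \<theta>) \<longlongrightarrow> 1) (at (0::real))"
    using DERIV_sin[of "0::real"] by (simp add: has_field_derivative_iff)
  then have "((\<lambda>\<theta>. (sin \<theta> / \<theta>)\<^sup>2 / (1 + cos \<theta>) * (\<Sum>k<n. cos \<theta> ^ k)) \<longlongrightarrow>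
          1\<^sup>2 / (1 + cos 0) * (\<Sum>k<n. cos 0 ^ k)) (at (0::real))"
    by (intro tendsto_intros) auto
  moreover have "\<forall>\<^sub>F \<theta> in at (0::real).
      (sin \<theta> / \<theta>)\<^sup>2 / (1 + cos \<theta>) * (\<Sum>k<n. cos \<theta> ^ k) = (1 - cos \<theta> ^ n) / \<theta>\<^sup>2"
  proof -
    have "((\<lambda>\<theta>. 1 + cos \<theta>) \<longlongrightarrow> 1 + cos 0) (at (0::real))"
      by (intro tendsto_intros)
    then have "\<forall>\<^sub>F \<theta> in at (0::real). 1 + cos \<theta> > 0"
      by (rule order_tendstoD) auto
    then show ?thesis
    proof eventually_elim
      case (elim \<theta>)
      have "(sin \<theta>)\<^sup>2 = (1 - cos \<theta>) * (1 + cos \<theta>)"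
        using sin_cos_squared_add[of \<theta>] by (simp add: power2_eq_square algebra_simps)
      then have "(sin \<theta> / \<theta>)\<^sup>2 / (1 + cos \<theta>) = (1 - cos \<theta>) / \<theta>\<^sup>2"
        using elim by (simp add: power_divide)
      then show ?case by (simp add: one_diff_power_eq)
    qed
  qed
  ultimately show ?thesis by (simp add: filterlim_cong)
qed

lemma summable_if_second_deriv_0:
  assumes \<psi>: "schoenberg_seq \<psi> b" and "has_finite_second_deriv_0 \<psi>"
  shows "summable (\<lambda>n. b (n + 1) * (real n + 1))"
proof -
  note b = schoenberg_seqD[OF \<psi>]
  obtain K where K: "\<forall>\<^sub>F \<theta> in at_right 0. \<bar>\<psi> \<theta> - \<psi> 0\<bar> \<le> K * \<theta>\<^sup>2"
    using quadratic_bound_if_second_deriv_0[OF assms(2)] .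
  have \<psi>0: "\<psi> 0 = 1"
    using b(5) b(6)[of 0] by (simp add: cos_series_def)
  \<comment> \<open>With \<open>N\<close> fixed, the limit in \<theta> concerns a finite sum only.
    The bound \<open>K\<close> does not depend on \<open>N\<close>, because the omitted terms of
    \<open>1 - \<psi> \<theta>\<close> are nonnegative.\<close>
  have "(\<Sum>n<N. b n * (real n / 2)) \<le> K" for N
  proof (rule tendsto_upperbound)
    show "((\<lambda>\<theta>. \<Sum>n<N. b n * ((1 - cos \<theta> ^ n) / \<theta>\<^sup>2)) \<longlongrightarrow> (\<Sum>n<N. b n * (real n / 2)))
        (at_right 0)"
      by (intro tendsto_intros tendsto_within_subset[OF tendsto_one_minus_cos_power]) auto
    have "\<forall>\<^sub>F \<theta> in at_right 0. \<theta> \<in> {0<..<pi}"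
      by (rule eventually_at_right_real) simp
    with K show "\<forall>\<^sub>F \<theta> in at_right 0. (\<Sum>n<N. b n * ((1 - cos \<theta> ^ n) / \<theta>\<^sup>2)) \<le> K"
    proof eventually_elim
      case (elim \<theta>)
      have "(\<lambda>n. b n - b n * cos \<theta> ^ n) sums (1 - \<psi> \<theta>)"
        using \<psi> elim unfolding schoenberg_seq_def by (intro sums_diff) auto
      then have "(\<lambda>n. b n * (1 - cos \<theta> ^ n)) sums (1 - \<psi> \<theta>)"
        by (simp add: algebra_simps)
      moreover have "b n * (1 - cos \<theta> ^ n) \<ge> 0" for n
        using b(1) abs_mult_cos_power_le[of 1 \<theta> n] by simp
      ultimately have "(\<Sum>n<N. b n * (1 - cos \<theta> ^ n)) \<le> 1 - \<psi> \<theta>"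
        using sum_le_suminf[of "\<lambda>n. b n * (1 - cos \<theta> ^ n)" "{..<N}"] by (simp add: sums_iff)
      also have "\<dots> \<le> K * \<theta>\<^sup>2" using elim \<psi>0 by simp
      finally have "(\<Sum>n<N. b n * (1 - cos \<theta> ^ n)) / \<theta>\<^sup>2 \<le> K"
        using elim by (simp add: divide_le_eq)
      then show ?case by (simp add: sum_divide_distrib)
    qed
  qed auto
  then have "summable (\<lambda>n. b n * (real n / 2))"
    using b(1) by (intro summableI_nonneg_bounded) auto
  then have "summable (\<lambda>n. real n * b n)"
    using summable_mult[of "\<lambda>n. b n * (real n / 2)" 2] by (simp add: mult.commute)
  then show ?thesis
    using summable_Suc_iff[of "\<lambda>n. real n * b n"] by (simp add: algebra_simps)
qed


section \<open>The antiderivative series and the integrals of the montee\<close>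

lemma summable_divide_Suc:
  assumes "summable (\<lambda>n. \<bar>b n\<bar>)"
  shows "summable (\<lambda>n. \<bar>b n / (real n + 1)\<bar>)"
proof (rule summable_comparison_test'[OF assms])
  show "norm \<bar>b n / (real n + 1)\<bar> \<le> \<bar>b n\<bar>" for n
    using mult_left_mono[of 1 "real n + 1" "\<bar>b n\<bar>"] by (simp add: divide_le_eq)
qed

text \<open>These are the coefficients of the antiderivative series. The constant coefficient
  \<open>0\<close> selects the antiderivative that vanishes at \<open>pi / 2\<close>.\<close>

lemma summable_shift_divide:
  assumes "summable (\<lambda>n. \<bar>b n\<bar>)"
  shows "summable (\<lambda>n. \<bar>if n = 0 then 0 else b (n - 1) / real n\<bar>)"
  using summable_divide_Suc[OF assms]
    summable_Suc_iff[of "\<lambda>n. \<bar>if n = 0 then 0 else b (n - 1) / real n\<bar>"]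
  by (simp add: add.commute)

lemma cos_series_shift_divide_sums:
  assumes "summable (\<lambda>n. \<bar>b n\<bar>)"
  shows "(\<lambda>n. b n / (real n + 1) * cos \<theta> ^ (n + 1)) sums
           cos_series (\<lambda>n. if n = 0 then 0 else b (n - 1) / real n) \<theta>"
proof -
  define a where "a n = (if n = 0 then 0 else b (n - 1) / real n)" for n
  have "summable (\<lambda>n. \<bar>a n\<bar>)"
    unfolding a_def by (rule summable_shift_divide[OF assms])
  then have "(\<lambda>n. a n * cos \<theta> ^ n) sums cos_series a \<theta>"
    by (rule cos_series_sums)
  then show ?thesis
    using sums_Suc_iff[of "\<lambda>n. a n * cos \<theta> ^ n"] by (simp add: a_def[abs_def] add.commute)
qed

text \<open>The division by \<open>n\<close> cancels the factor produced by differentiation, so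
  absolute summability of \<open>b\<close> is enough.\<close>

lemma has_real_derivative_cos_series_shift_divide:
  assumes "summable (\<lambda>n. \<bar>b n\<bar>)"
  shows "(cos_series (\<lambda>n. if n = 0 then 0 else b (n - 1) / real n) has_real_derivative
           - sin \<theta> * cos_series b \<theta>) (at \<theta>)"
proof -
  define a where "a n = (if n = 0 then 0 else b (n - 1) / real n)" for n
  have "summable (\<lambda>n. \<bar>a n\<bar>)"
    unfolding a_def by (rule summable_shift_divide[OF assms])
  moreover have shift: "a (n + 1) * (real n + 1) = b n" for n
    by (simp add: a_def add.commute)
  ultimately have "(cos_series a has_real_derivative - sin \<theta> * cos_series b \<theta>) (at \<theta>)"
    using has_real_derivative_cos_series[of a \<theta>] assms by (simp only: shift)
  then show ?thesis unfolding a_def[abs_def] .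
qed

lemma has_integral_sin_mult:
  assumes \<psi>: "schoenberg_seq \<psi> b" and "\<theta> \<in> {0..pi}"
  shows "((\<lambda>\<beta>. sin \<beta> * \<psi> \<beta>) has_integral
           (\<Sum>n. b n * ((- 1) ^ n / (real n + 1)))
           + cos_series (\<lambda>n. if n = 0 then 0 else b (n - 1) / real n) \<theta>) {\<theta>..pi}"
proof -
  note b = schoenberg_seqD[OF \<psi>]
  define H where "H = cos_series (\<lambda>n. if n = 0 then 0 else b (n - 1) / real n)"
  have "((\<lambda>\<beta>. - sin \<beta> * cos_series b \<beta>) has_integral H pi - H \<theta>) {\<theta>..pi}"
  proof (rule fundamental_theorem_of_calculus)
    show "(H has_vector_derivative - sin t * cos_series b t) (at t within {\<theta>..pi})" for t
      unfolding H_def has_real_derivative_iff_has_vector_derivative[symmetric]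
      by (rule has_field_derivative_at_within[OF has_real_derivative_cos_series_shift_divide[OF b(3)]])
  qed (use assms(2) in simp)
  then have "((\<lambda>\<beta>. - (- sin \<beta> * cos_series b \<beta>)) has_integral - (H pi - H \<theta>)) {\<theta>..pi}"
    by (rule has_integral_neg)
  \<comment> \<open>At \<open>pi\<close> the power \<open>cos pi ^ (n + 1)\<close> is
    \<open>- ((- 1) ^ n)\<close>, which yields the alternating sum.\<close>
  moreover have "H pi = - (\<Sum>n. b n * ((- 1) ^ n / (real n + 1)))"
  proof -
    have "(\<lambda>n. b n / (real n + 1) * cos pi ^ (n + 1)) sums H pi"
      unfolding H_def by (rule cos_series_shift_divide_sums[OF b(3)])
    then have "(\<lambda>n. b n * ((- 1) ^ n / (real n + 1))) sums - H pi"
      using sums_minus by fastforce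
    then show ?thesis by (simp add: sums_iff)
  qed
  ultimately have "((\<lambda>\<beta>. sin \<beta> * cos_series b \<beta>) has_integral
      (\<Sum>n. b n * ((- 1) ^ n / (real n + 1))) + H \<theta>) {\<theta>..pi}"
    by (simp add: add.commute)
  then show ?thesis
    unfolding H_def by (rule has_integral_eq[rotated]) (use assms(2) b(6) in simp)
qed

text \<open>At odd indices the two summands cancel, at even ones they coincide. This identifies the
  integral over \<open>{0..pi}\<close> with the constant \<open>G1\<close>.\<close>

lemma even_part_sums:
  assumes "summable (\<lambda>n. \<bar>b n\<bar>)"
  shows "(\<lambda>n. b (2 * n) / (2 * real n + 1)) sums
           (((\<Sum>n. b n * ((- 1) ^ n / (real n + 1))) + (\<Sum>n. b n / (real n + 1))) / 2)"
proof -
  define g where "g n = b n * ((- 1) ^ n / (real n + 1)) + b n / (real n + 1)" for n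
  let ?s = "(\<Sum>n. b n * ((- 1) ^ n / (real n + 1))) + (\<Sum>n. b n / (real n + 1))"
  have "summable (\<lambda>n. \<bar>b n * ((- 1) ^ n / (real n + 1))\<bar>)" "summable (\<lambda>n. \<bar>b n / (real n + 1)\<bar>)"
    using summable_divide_Suc[OF assms] by (simp_all add: abs_mult abs_divide power_abs)
  then have "g sums ?s"
    unfolding g_def by (intro sums_add summable_sums) (rule summable_rabs_cancel, assumption)+
  moreover have "g n = 0" if "n \<notin> range (\<lambda>n. 2 * n)" for n
  proof -
    have "odd n" using that by (auto elim!: evenE)
    then show ?thesis by (simp add: g_def)
  qed
  ultimately have "(\<lambda>n. g (2 * n)) sums ?s"
    using sums_mono_reindex[of "\<lambda>n::nat. 2 * n" g ?s] by (simp add: strict_mono_def)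
  then have "(\<lambda>n. 2 * (b (2 * n) / (2 * real n + 1))) sums ?s"
    by (simp add: g_def)
  then show ?thesis
    using sums_mult[of _ ?s "1/2"] by fastforce
qed

section \<open>The descente and its continuous extension\<close>

text \<open>The factor \<open>- sin \<theta>\<close> of the derivative cancels against
  \<open>sin \<theta>\<close> and the negative sign of the second derivative.\<close>

lemma descente_eq:
  assumes \<psi>: "schoenberg_seq \<psi> b" and sm: "summable (\<lambda>n. b (n + 1) * (real n + 1))"
    and "\<theta> \<in> {0<..<pi}"
  shows "descente \<psi> \<theta> = cos_series (\<lambda>n. b (n + 1) * (real n + 1)) \<theta> / (\<Sum>n. b (n + 1) * (real n + 1))"
proof -
  note b = schoenberg_seqD[OF \<psi>]
  have sm': "summable (\<lambda>n. \<bar>b (n + 1) * (real n + 1)\<bar>)"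
    using sm b(1) by (simp add: abs_mult)
  have "\<forall>\<^sub>F t in nhds \<theta>. t \<in> {0<..<pi}"
    using assms(3) by (intro eventually_nhds_in_open) auto
  then have "\<forall>\<^sub>F t in nhds \<theta>. \<psi> t = cos_series b t"
    by eventually_elim (simp add: b(6))
  then have "(\<psi> has_real_derivative - sin \<theta> * cos_series (\<lambda>n. b (n + 1) * (real n + 1)) \<theta>) (at \<theta>)"
    using has_real_derivative_cos_series[OF b(3) sm'] by (simp add: DERIV_cong_ev[OF refl _ refl])
  moreover have "sin \<theta> \<noteq> 0"
    using assms(3) sin_gt_zero[of \<theta>] by simp
  ultimately show ?thesis
    unfolding descente_def second_deriv_0_if_summable(2)[OF \<psi> sm]
    by (simp add: DERIV_imp_deriv)
qed

lemma differentiable_on_if_summable: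
  assumes \<psi>: "schoenberg_seq \<psi> b" and sm: "summable (\<lambda>n. b (n + 1) * (real n + 1))"
  shows "\<psi> differentiable_on {0..pi}"
proof -
  note b = schoenberg_seqD[OF \<psi>]
  have sm': "summable (\<lambda>n. \<bar>b (n + 1) * (real n + 1)\<bar>)"
    using sm b(1) by (simp add: abs_mult)
  have "\<psi> differentiable (at \<theta> within {0..pi})" if "\<theta> \<in> {0..pi}" for \<theta>
  proof (rule differentiable_transform_within[OF _ zero_less_one that])
    show "cos_series b differentiable (at \<theta> within {0..pi})"
      using has_real_derivative_cos_series[OF b(3) sm', of \<theta>]
      by - (rule differentiable_at_withinI, auto simp: real_differentiable_def)
  qed (simp add: b(6))
  then show ?thesis by (simp add: differentiable_on_def)
qed

text \<open>The open interval is dense in \<open>{0..pi}\<close>. Thus the Schoenberg sequence of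
  one explicit extension serves for every extension.\<close>

lemma continuous_extension_unique:
  assumes "is_continuous_extension f \<phi>" "is_continuous_extension f \<xi>" "\<theta> \<in> {0..pi}"
  shows "\<phi> \<theta> = \<xi> \<theta>"
proof -
  have cl: "closure {0<..<pi} = {0..pi}" by simp
  have "continuous_on (closure {0<..<pi}) (\<lambda>t. \<phi> t - \<xi> t)"
    using assms(1,2) unfolding is_continuous_extension_def cl by (intro continuous_on_diff) auto
  moreover have "\<phi> t - \<xi> t = 0" if "t \<in> {0<..<pi}" for t
    using assms(1,2) that by (simp add: is_continuous_extension_def)
  ultimately have "\<phi> \<theta> - \<xi> \<theta> = 0"
    by (rule continuous_constant_on_closure) (use assms(3) cl in simp_all)
  then show ?thesis by simp
qed

lemma schoenberg_seq_cong:
  assumes "schoenberg_seq \<phi> b" "\<And>\<theta>. \<theta> \<in> {0..pi} \<Longrightarrow> \<phi> \<theta> = \<xi> \<theta>"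
  shows "schoenberg_seq \<xi> b"
  using assms by (auto simp: schoenberg_seq_def)

section \<open>The four assertions on montee and descente\<close>

theorem proposition3p5:
  fixes \<psi> :: "real \<Rightarrow> real" and b :: "nat \<Rightarrow> real" and A G1 G2 :: real
  defines "A \<equiv> (\<Sum>n. b n * ((-1) ^ n / (real n + 1)))"
    and "G1 \<equiv> 2 * (\<Sum>n. b (2 * n) / (2 * real n + 1))"
    and "G2 \<equiv> (\<Sum>n. b (n + 1) * (real n + 1))"
  assumes "\<psi> \<in> Psi_inf" and "schoenberg_seq \<psi> b"
  shows
    "((montee_well_defined \<psi> \<and> montee \<psi> \<in> Psi_inf \<longleftrightarrow> A \<ge> 0) \<and>
      (A \<ge> 0 \<longrightarrow>
         schoenberg_seq (montee \<psi>) (\<lambda>n. if n = 0 then A / G1 else b (n - 1) / (real n * G1)))) \<and>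
     (A \<ge> 0 \<longleftrightarrow> integral {pi / 2..pi} (\<lambda>\<theta>. sin \<theta> * \<psi> \<theta>) \<ge> 0) \<and>
     ((\<exists>\<theta>\<in>{0..pi}. \<psi> \<theta> \<noteq> 1) \<longrightarrow>
      (descente_well_defined \<psi> \<and> (\<exists>\<phi>. is_continuous_extension (descente \<psi>) \<phi> \<and> \<phi> \<in> Psi_inf)
         \<longleftrightarrow> summable (\<lambda>n. b (n + 1) * (real n + 1))) \<and>
      (summable (\<lambda>n. b (n + 1) * (real n + 1)) \<longrightarrow>
         (\<forall>\<phi>. is_continuous_extension (descente \<psi>) \<phi> \<longrightarrow>
            schoenberg_seq \<phi> (\<lambda>n. b (n + 1) * (real n + 1) / G2)))) \<and>
     (summable (\<lambda>n. b (n + 1) * (real n + 1)) \<longleftrightarrow> has_finite_second_deriv_0 \<psi>)"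
proof -
  note \<psi> = \<open>schoenberg_seq \<psi> b\<close>
  note b = schoenberg_seqD[OF \<psi>]
  let ?S = "summable (\<lambda>n. b (n + 1) * (real n + 1))"
  define H where "H = cos_series (\<lambda>n. if n = 0 then 0 else b (n - 1) / real n)"
  have H: "(\<lambda>n. b n / (real n + 1) * cos \<theta> ^ (n + 1)) sums H \<theta>" for \<theta>
    unfolding H_def by (rule cos_series_shift_divide_sums[OF b(3)])
  have has_int: "((\<lambda>\<beta>. sin \<beta> * \<psi> \<beta>) has_integral A + H \<theta>) {\<theta>..pi}" if "\<theta> \<in> {0..pi}" for \<theta>
    unfolding A_def H_def by (rule has_integral_sin_mult[OF \<psi> that])
  note int = integral_unique[OF has_int]
  have H0: "(\<lambda>n. b n / (real n + 1)) sums H 0" using H[of 0] by simp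
  have G1: "G1 = A + H 0"
    using even_part_sums[OF b(3)] H0 by (simp add: G1_def A_def sums_iff)
  have "G1 \<ge> 0"
    using even_part_sums[OF b(3)] b(1) by (auto simp: G1_def intro!: suminf_nonneg sums_summable)
  \<comment> \<open>Some coefficient is nonzero since they sum to \<open>1\<close>. Hence
    \<open>G1 = A + H 0\<close> is strictly positive as soon as \<open>A \<ge> 0\<close>, which
    makes the montee well-defined.\<close>
  have "H 0 > 0"
  proof -
    obtain n where "b n \<noteq> 0"
      using b(5) by (cases "b = (\<lambda>_. 0)") auto
    then have "b n / (real n + 1) > 0"
      using b(1)[of n] by simp
    then show ?thesis
      using H0 b(1) suminf_pos2[of "\<lambda>n. b n / (real n + 1)" n] by (simp add: sums_iff)
  qed
  \<comment> \<open>Every exponent in the series is at least \<open>1\<close>. So the integral from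
    \<open>pi / 2\<close> is \<open>A\<close>, and the montee takes the value \<open>A / G1\<close>
    there.\<close>
  have half: "H (pi / 2) = 0"
    using H[of "pi / 2"] by (simp add: sums_iff)
  have montee: "montee \<psi> \<theta> = (A + H \<theta>) / G1" if "\<theta> \<in> {0..pi}" for \<theta>
    using int[OF that] int[of 0] by (simp add: montee_def G1)
  have A_nonneg: "A \<ge> 0" if "montee_well_defined \<psi>" "montee \<psi> \<in> Psi_inf"
  proof -
    \<comment> \<open>For \<open>G1 = 0\<close> the quotient \<open>A / G1\<close> would be
      \<open>0\<close> by convention and carry no information on the sign of
      \<open>A\<close>.\<close>
    have "G1 \<noteq> 0" using that(1) int[of 0] by (simp add: montee_well_defined_def G1)
    moreover have "A / G1 \<ge> 0"
      using Psi_inf_right_angle_nonneg[OF that(2)] montee[of "pi / 2"] half by simp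
    ultimately show ?thesis using \<open>G1 \<ge> 0\<close> by (simp add: zero_le_divide_iff)
  qed
  have montee_seq: "schoenberg_seq (montee \<psi>) (\<lambda>n. if n = 0 then A / G1 else b (n - 1) / (real n * G1))"
    (is "schoenberg_seq _ ?a") and montee_wd: "montee_well_defined \<psi>" if "A \<ge> 0"
  proof -
    have "G1 > 0" using that \<open>H 0 > 0\<close> G1 by simp
    have sums: "(\<lambda>n. ?a n * cos \<theta> ^ n) sums montee \<psi> \<theta>" if "\<theta> \<in> {0..pi}" for \<theta>
    proof -
      have "(\<lambda>n. ?a (Suc n) * cos \<theta> ^ Suc n) sums (H \<theta> / G1)"
        using sums_divide[OF H[of \<theta>], of G1] by (simp add: add.commute)
      then have "(\<lambda>n. ?a n * cos \<theta> ^ n) sums (H \<theta> / G1 + ?a 0 * cos \<theta> ^ 0)"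
        by (rule sums_Suc)
      then show ?thesis
        by (simp only: montee[OF that] add_divide_distrib) (simp add: add.commute)
    qed
    \<comment> \<open>At angle \<open>0\<close> all powers of the cosine are \<open>1\<close>, so
      the value there is the sum of the coefficients.\<close>
    have "montee \<psi> 0 = 1"
      using \<open>G1 > 0\<close> montee[of 0] G1 by simp
    then have "?a sums 1"
      using sums[of 0] by simp
    moreover have "?a n \<ge> 0" for n
      using b(1) \<open>A \<ge> 0\<close> \<open>G1 > 0\<close> by simp
    ultimately show "schoenberg_seq (montee \<psi>) ?a"
      using sums unfolding schoenberg_seq_def by blast
    show "montee_well_defined \<psi>"
      using has_int[of 0] int[of 0] \<open>G1 > 0\<close> G1 unfolding montee_well_defined_def
      by (simp add: has_integral_integrable)
  qed
  have b_part: "integral {pi / 2..pi} (\<lambda>\<theta>. sin \<theta> * \<psi> \<theta>) = A"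
    using int[of "pi / 2"] half by simp
  have d: "?S \<longleftrightarrow> has_finite_second_deriv_0 \<psi>"
    using second_deriv_0_if_summable(1)[OF \<psi>] summable_if_second_deriv_0[OF \<psi>] by blast
  have descente_wd: "descente_well_defined \<psi>"
    and descente_Psi: "\<exists>\<phi>. is_continuous_extension (descente \<psi>) \<phi> \<and> \<phi> \<in> Psi_inf"
    and descente_seq: "\<And>\<phi>. is_continuous_extension (descente \<psi>) \<phi> \<Longrightarrow>
            schoenberg_seq \<phi> (\<lambda>n. b (n + 1) * (real n + 1) / G2)"
    if nontriv: "\<exists>\<theta>\<in>{0..pi}. \<psi> \<theta> \<noteq> 1" and S: ?S
  proof -
    define h where "h = cos_series (\<lambda>n. b (n + 1) * (real n + 1))"
    have S': "summable (\<lambda>n. \<bar>b (n + 1) * (real n + 1)\<bar>)"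
      using S b(1) by (simp add: abs_mult)
    \<comment> \<open>Otherwise the series would not depend on the angle and \<open>\<psi>\<close>
      would be constantly \<open>1\<close>. This gives \<open>G2 > 0\<close>, hence a nonzero second
      derivative at \<open>0\<close>.\<close>
    have "\<exists>n. b (n + 1) \<noteq> 0"
    proof (rule ccontr)
      assume "\<nexists>n. b (n + 1) \<noteq> 0"
      then have "b n = 0" if "n \<noteq> 0" for n
        using that by (metis Suc_eq_plus1 not0_implies_Suc)
      then have const: "b n * cos \<theta> ^ n = b n" for n \<theta>
        by (cases "n = 0") simp_all
      have "\<psi> \<theta> = 1" if "\<theta> \<in> {0..pi}" for \<theta>
        by (simp only: b(5) b(6)[OF that] cos_series_def const)
      then show False using nontriv by blast
    qed
    then obtain n where "b (n + 1) \<noteq> 0" by blast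
    then have "b (n + 1) * (real n + 1) > 0"
      using b(1)[of "n + 1"] by (intro mult_pos_pos) auto
    then have "G2 > 0"
      unfolding G2_def using b(1) by (intro suminf_pos2[OF S, of n]) auto
    then show "descente_well_defined \<psi>"
      using differentiable_on_if_summable[OF \<psi> S] second_deriv_0_if_summable[OF \<psi> S]
      by (simp add: descente_well_defined_def G2_def)
    have ext: "is_continuous_extension (descente \<psi>) (\<lambda>\<theta>. h \<theta> / G2)"
      using \<open>G2 > 0\<close> continuous_on_cos_series[OF S'] descente_eq[OF \<psi> S]
      unfolding is_continuous_extension_def h_def G2_def by (intro conjI continuous_on_divide) simp_all
    have "(\<lambda>n. b (n + 1) * (real n + 1) / G2 * cos \<theta> ^ n) sums (h \<theta> / G2)" for \<theta>
      using sums_divide[OF cos_series_sums[OF S', of \<theta>], of G2] by (simp add: h_def)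
    moreover have "(\<lambda>n. b (n + 1) * (real n + 1) / G2) sums 1"
      using sums_divide[OF summable_sums[OF S], of G2] \<open>G2 > 0\<close> by (simp add: G2_def)
    ultimately have seq: "schoenberg_seq (\<lambda>\<theta>. h \<theta> / G2) (\<lambda>n. b (n + 1) * (real n + 1) / G2)"
      using b(1) \<open>G2 > 0\<close> by (simp add: schoenberg_seq_def)
    show "\<exists>\<phi>. is_continuous_extension (descente \<psi>) \<phi> \<and> \<phi> \<in> Psi_inf"
      using ext schoenberg_seq_imp_Psi_inf[OF seq] by blast
    show "schoenberg_seq \<phi> (\<lambda>n. b (n + 1) * (real n + 1) / G2)"
      if "is_continuous_extension (descente \<psi>) \<phi>" for \<phi>
      by (rule schoenberg_seq_cong[OF seq continuous_extension_unique[OF ext that]])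
  qed
  have S_if_descente: ?S if "descente_well_defined \<psi>"
    using that d by (simp add: descente_well_defined_def)
  have "montee_well_defined \<psi> \<and> montee \<psi> \<in> Psi_inf \<longleftrightarrow> A \<ge> 0"
    using A_nonneg montee_wd schoenberg_seq_imp_Psi_inf[OF montee_seq] by blast
  moreover have "descente_well_defined \<psi> \<and> (\<exists>\<phi>. is_continuous_extension (descente \<psi>) \<phi> \<and> \<phi> \<in> Psi_inf)
      \<longleftrightarrow> ?S" if "\<exists>\<theta>\<in>{0..pi}. \<psi> \<theta> \<noteq> 1"
    using S_if_descente descente_wd[OF that] descente_Psi[OF that] by blast
  ultimately show ?thesis
    unfolding b_part using montee_seq descente_seq d by (intro conjI impI allI) simp_all
qed

end
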